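(* Let $S$ be a finite regular semigroup and let $G(S)$ be its graph of inverses. Then $S$ has an involution matching if and only if $G(S)$ has a $1$-factor, and $S$ has a permutation matching if and only if $G(S)$ has a $1,2$-factor.
   Context: In a semigroup $S$, $u$ and $v$ are mutually inverse if $uvu=u$ and $vuv=v$; $V(a)$ denotes the set of inverses of $a$. A permutation matching of $S$ is a permutation $f$ of the set $S$ with $f(a)\in V(a)$ for all $a\in S$; it is an involution matching if moreover $f^2$ is the identity map. Graphs are finite and undirected, may have loops, and have no multiple edges. The graph of inverses $G(S)$ has vertex set $S$, and $uv$ is an edge if and only if $u$ and $v$ are mutually inverse (so there is a loop at $a$ exactly when $a=a^3$). A $1$-factor of a graph $G$ is a set of pairwise disjoint edges of $G$ (loops being allowed as edges) that together cover all vertices of $G$. A $1,2$-factor of $G$ is a spanning subgraph of $G$ each of whose components is either a single edge (possibly a loop) or a cycle (of length at least $3$). *)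

theory Defs
  imports Main "HOL-Combinatorics.Permutations"
begin

section \<open>Finite regular semigroups and matchings by inverses\<close>

locale semigroup_on =
  fixes S :: "'a set" and mul :: "'a \<Rightarrow> 'a \<Rightarrow> 'a"
  assumes closed: "a \<in> S \<Longrightarrow> b \<in> S \<Longrightarrow> mul a b \<in> S"
    and assoc: "a \<in> S \<Longrightarrow> b \<in> S \<Longrightarrow> c \<in> S \<Longrightarrow> mul (mul a b) c = mul a (mul b c)"

locale regular_semigroup_on = semigroup_on +
  assumes regular: "a \<in> S \<Longrightarrow> \<exists>x\<in>S. mul (mul a x) a = a"

definition mutually_inverse :: "('a \<Rightarrow> 'a \<Rightarrow> 'a) \<Rightarrow> 'a \<Rightarrow> 'a \<Rightarrow> bool" where
  "mutually_inverse mul u v \<longleftrightarrow>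
     mul (mul u v) u = u \<and> mul (mul v u) v = v"

definition inverses :: "'a set \<Rightarrow> ('a \<Rightarrow> 'a \<Rightarrow> 'a) \<Rightarrow> 'a \<Rightarrow> 'a set" where
  "inverses S mul a = {b \<in> S. mutually_inverse mul a b}"

text \<open>A permutation of \<open>S\<close> is a total function that is the identity outside \<open>S\<close>
  (this is \<^const>\<open>permutes\<close>), so \<open>f \<circ> f = id\<close> says exactly that \<open>f\<close> squares to the
  identity on \<open>S\<close>.\<close>

definition permutation_matching ::
  "'a set \<Rightarrow> ('a \<Rightarrow> 'a \<Rightarrow> 'a) \<Rightarrow> ('a \<Rightarrow> 'a) \<Rightarrow> bool" where
  "permutation_matching S mul f \<longleftrightarrow> f permutes S \<and> (\<forall>a\<in>S. f a \<in> inverses S mul a)"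

definition involution_matching ::
  "'a set \<Rightarrow> ('a \<Rightarrow> 'a \<Rightarrow> 'a) \<Rightarrow> ('a \<Rightarrow> 'a) \<Rightarrow> bool" where
  "involution_matching S mul f \<longleftrightarrow> permutation_matching S mul f \<and> f \<circ> f = id"


section \<open>Undirected graphs with loops\<close>

text \<open>An edge is the set of its end points: a two-element set is an ordinary edge and a
  singleton \<open>{a} = {a, a}\<close> is a loop at \<open>a\<close>. Multiple edges are thereby excluded.\<close>

datatype 'a ugraph = UGraph (verts: "'a set") (edges: "'a set set")

definition finite_ugraph :: "'a ugraph \<Rightarrow> bool" where
  "finite_ugraph G \<longleftrightarrow>
     finite (verts G) \<and> (\<forall>e\<in>edges G. \<exists>u\<in>verts G. \<exists>v\<in>verts G. e = {u, v})"

definition spanning_subgraph :: "'a ugraph \<Rightarrow> 'a ugraph \<Rightarrow> bool" where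
  "spanning_subgraph H G \<longleftrightarrow> verts H = verts G \<and> edges H \<subseteq> edges G"

definition adjacency :: "'a ugraph \<Rightarrow> ('a \<times> 'a) set" where
  "adjacency G = {(u, v). {u, v} \<in> edges G}"

definition component_of :: "'a ugraph \<Rightarrow> 'a \<Rightarrow> 'a ugraph" where
  "component_of G v =
     (let C = (adjacency G)\<^sup>* `` {v} in UGraph C {e \<in> edges G. e \<subseteq> C})"

definition components :: "'a ugraph \<Rightarrow> 'a ugraph set" where
  "components G = component_of G ` verts G"

text \<open>In \<open>single_edge\<close> the case \<open>u = v\<close> is a vertex carrying a loop; a vertex without a loop
  does not qualify.\<close>

definition single_edge :: "'a ugraph \<Rightarrow> bool" where
  "single_edge K \<longleftrightarrow> (\<exists>u v. K = UGraph {u, v} {{u, v}})"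

definition cycle_graph :: "'a ugraph \<Rightarrow> bool" where
  "cycle_graph K \<longleftrightarrow>
     (\<exists>xs. distinct xs \<and> length xs \<ge> 3 \<and>
       K = UGraph (set xs) {{xs ! i, xs ! (Suc i mod length xs)} | i. i < length xs})"

definition one_factor :: "'a ugraph \<Rightarrow> 'a set set \<Rightarrow> bool" where
  "one_factor G F \<longleftrightarrow> F \<subseteq> edges G \<and> pairwise disjnt F \<and> \<Union>F = verts G"

definition one_two_factor :: "'a ugraph \<Rightarrow> 'a ugraph \<Rightarrow> bool" where
  "one_two_factor G H \<longleftrightarrow>
     spanning_subgraph H G \<and> (\<forall>K\<in>components H. single_edge K \<or> cycle_graph K)"


section \<open>The graph of inverses\<close>

definition graph_of_inverses :: "'a set \<Rightarrow> ('a \<Rightarrow> 'a \<Rightarrow> 'a) \<Rightarrow> 'a ugraph" where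
  "graph_of_inverses S mul =
     UGraph S {{u, v} | u v. u \<in> S \<and> v \<in> S \<and> mutually_inverse mul u v}"

lemma finite_ugraph_graph_of_inverses:
  "finite S \<Longrightarrow> finite_ugraph (graph_of_inverses S mul)"
  by (auto simp: finite_ugraph_def graph_of_inverses_def)

lemma edge_graph_of_inverses_iff:
  "{u, v} \<in> edges (graph_of_inverses S mul) \<longleftrightarrow>
     u \<in> S \<and> v \<in> S \<and> mutually_inverse mul u v"
  by (auto simp: graph_of_inverses_def mutually_inverse_def doubleton_eq_iff)

lemma loop_graph_of_inverses_iff:
  "{a} \<in> edges (graph_of_inverses S mul) \<longleftrightarrow> a \<in> S \<and> mul (mul a a) a = a"
  using edge_graph_of_inverses_iff[of a a S mul] by (auto simp: mutually_inverse_def)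

end

theory Submission
  imports Defs "HOL-Combinatorics.Cycles"
begin

text \<open>Both equivalences hold for an arbitrary finite graph and its permutations that send every
  vertex to a neighbour. The edges \<open>{a, f a}\<close> of such a permutation \<open>f\<close> form the factor: its
  components are the orbits of \<open>f\<close>, and orbits of length 1 and 2 give loops and single edges.
  Conversely, one rotates every component of a factor along itself.\<close>

section \<open>Circuits as closed walks of a successor map\<close>

text \<open>Without the length bound of \<open>cycle_graph\<close>, loops, single edges and cycles
  become one case: for length 1 the index wraps to itself, and for length 2 both indices give the
  same set.\<close>

definition circuit :: "'a list \<Rightarrow> 'a ugraph" where
  "circuit xs = UGraph (set xs) {{xs ! i, xs ! (Suc i mod length xs)} | i. i < length xs}"

text \<open>Circuits of length 1 and 2 are the single edges.\<close>

lemma single_edge_or_cycle_graph_iff: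
  "single_edge K \<or> cycle_graph K \<longleftrightarrow> (\<exists>xs. distinct xs \<and> xs \<noteq> [] \<and> K = circuit xs)"
proof
  assume "single_edge K \<or> cycle_graph K"
  then show "\<exists>xs. distinct xs \<and> xs \<noteq> [] \<and> K = circuit xs"
  proof
    assume "single_edge K"
    then obtain u v where K: "K = UGraph {u, v} {{u, v}}"
      by (auto simp: single_edge_def)
    show ?thesis
    proof (cases "u = v")
      case True
      have "K = circuit [u]"
        unfolding K circuit_def using True by auto
      then show ?thesis by (intro exI[of _ "[u]"]) simp
    next
      case False
      have "circuit [u, v] = K"
        unfolding K circuit_def by (force simp: less_Suc_eq insert_commute)
      then show ?thesis using False by (intro exI[of _ "[u, v]"]) auto
    qed
  next
    assume "cycle_graph K"
    then obtain xs where "distinct xs" "length xs \<ge> 3" "K = circuit xs"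
      unfolding cycle_graph_def circuit_def by blast
    then show ?thesis by (intro exI[of _ xs]) auto
  qed
next
  assume "\<exists>xs. distinct xs \<and> xs \<noteq> [] \<and> K = circuit xs"
  then obtain xs where xs: "distinct xs" "xs \<noteq> []" "K = circuit xs" by blast
  consider (one) u where "xs = [u]" | (two) u v where "xs = [u, v]" | (long) "length xs \<ge> 3"
  proof -
    obtain u ys where u: "xs = u # ys" using xs(2) by (cases xs) blast+
    show thesis
    proof (cases ys)
      case Nil
      with u one show ?thesis by simp
    next
      case (Cons v zs)
      show ?thesis
        by (cases zs) (use u Cons two long in simp_all)
    qed
  qed
  then show "single_edge K \<or> cycle_graph K"
  proof cases
    case one
    then have "K = UGraph {u, u} {{u, u}}"
      using xs(3) by (auto simp: circuit_def)
    then show ?thesis by (auto simp: single_edge_def)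
  next
    case two
    then have "K = UGraph {u, v} {{u, v}}"
      using xs(3) by (force simp: circuit_def less_Suc_eq insert_commute)
    then show ?thesis by (auto simp: single_edge_def)
  next
    case long
    then show ?thesis using xs unfolding cycle_graph_def circuit_def by blast
  qed
qed

text \<open>Trades indices for a successor map \<open>f\<close>, so that the edges get the form
  \<open>{a, f a}\<close> of a matching. It serves both directions, with \<open>f\<close> a
  permutation read along one orbit or \<open>f\<close> the rotation
  \<open>cycle_of_list xs\<close>.\<close>

lemma circuit_eq:
  assumes "\<And>i. i < length xs \<Longrightarrow> f (xs ! i) = xs ! (Suc i mod length xs)"
  shows "circuit xs = UGraph (set xs) ((\<lambda>a. {a, f a}) ` set xs)"
proof -
  have "{{xs ! i, xs ! (Suc i mod length xs)} | i. i < length xs} =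
      (\<lambda>a. {a, f a}) ` set xs"
    by (force simp: set_conv_nth assms)
  then show ?thesis by (simp add: circuit_def)
qed

lemma cycle_of_list_nth:
  assumes "distinct xs" "i < length xs"
  shows "cycle_of_list xs (xs ! i) = xs ! (Suc i mod length xs)"
proof -
  have "map (cycle_of_list xs) xs = rotate (Suc 0) xs"
    using cyclic_rotation[OF assms(1), of "Suc 0"] by simp
  then have "map (cycle_of_list xs) xs ! i = rotate (Suc 0) xs ! i" by (rule arg_cong)
  then show ?thesis using assms(2) by (simp add: nth_rotate del: rotate_Suc)
qed

section \<open>Matchings of a graph and 1-factors\<close>

definition graph_matching :: "'a ugraph \<Rightarrow> ('a \<Rightarrow> 'a) \<Rightarrow> bool" where
  "graph_matching G f \<longleftrightarrow> f permutes verts G \<and> (\<forall>a\<in>verts G. {a, f a} \<in> edges G)"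

lemma permutation_matching_iff:
  "permutation_matching S mul f \<longleftrightarrow> graph_matching (graph_of_inverses S mul) f"
  unfolding permutation_matching_def graph_matching_def edge_graph_of_inverses_iff
  by (auto simp: graph_of_inverses_def inverses_def permutes_in_image)

text \<open>The sets \<open>{a, f a}\<close> are the orbits of the involution \<open>f\<close>, so
  distinct ones are disjoint. Conversely, disjointness gives each vertex a unique partner, and
  \<open>f\<close> exchanges partners.\<close>

lemma involution_iff_one_factor:
  assumes "finite_ugraph G"
  shows "(\<exists>f. graph_matching G f \<and> f \<circ> f = id) \<longleftrightarrow> (\<exists>F. one_factor G F)"
proof
  assume "\<exists>f. graph_matching G f \<and> f \<circ> f = id"
  then obtain f where f: "f permutes verts G" "\<And>a. a \<in> verts G \<Longrightarrow> {a, f a} \<in> edges G"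
    and ff: "f (f a) = a" for a
    by (auto simp: graph_matching_def fun_eq_iff)
  have "disjnt {a, f a} {b, f b}" if "{a, f a} \<noteq> {b, f b}" for a b
    using that ff by (smt (verit, best) disjnt_insert1 disjnt_empty1 insertE insert_commute singletonD)
  then have "one_factor G ((\<lambda>a. {a, f a}) ` verts G)"
    using f by (auto simp: one_factor_def pairwise_def permutes_in_image)
  then show "\<exists>F. one_factor G F" ..
next
  assume "\<exists>F. one_factor G F"
  then obtain F where F: "F \<subseteq> edges G" "pairwise disjnt F" "\<Union>F = verts G"
    by (auto simp: one_factor_def)
  \<comment> \<open>If the edge that covers \<open>a\<close> is a loop, the partner \<open>b\<close>
    is \<open>a\<close> itself.\<close>
  have ex: "\<exists>b. {a, b} \<in> F" if a: "a \<in> verts G" for a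
  proof -
    obtain e where e: "e \<in> F" "a \<in> e" using a F(3) by blast
    then obtain u v where "e = {u, v}"
      using F(1) assms unfolding finite_ugraph_def by blast
    with e show ?thesis by (auto simp: insert_commute)
  qed
  have unique: "b = c" if "{a, b} \<in> F" "{a, c} \<in> F" for a b c
  proof -
    have "{a, b} = {a, c}"
      using pairwiseD[OF F(2) that] by (auto simp: disjnt_def)
    then show ?thesis by (auto simp: doubleton_eq_iff)
  qed
  \<comment> \<open>By \<open>unique\<close> the choice is forced on the vertices; the value
    \<open>a\<close> elsewhere is what \<open>permutes\<close> demands.\<close>
  define f where "f a = (if a \<in> verts G then SOME b. {a, b} \<in> F else a)" for a
  have f: "{a, f a} \<in> F" if "a \<in> verts G" for a
    unfolding f_def using that someI_ex[OF ex[OF that]] by simp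
  have fv: "f a \<in> verts G" if "a \<in> verts G" for a
    using f[OF that] F(3) by blast
  have ff: "f (f a) = a" for a
  proof (cases "a \<in> verts G")
    case True
    have "{f a, f (f a)} \<in> F" "{f a, a} \<in> F"
      using f[OF fv[OF True]] f[OF True] by (simp_all add: insert_commute)
    then show ?thesis by (rule unique)
  qed (simp add: f_def)
  have "f permutes verts G"
    unfolding permutes_def by (metis f_def ff)
  then have "graph_matching G f"
    using f F(1) by (auto simp: graph_matching_def)
  with ff show "\<exists>f. graph_matching G f \<and> f \<circ> f = id"
    by (auto simp: fun_eq_iff)
qed

section \<open>Components, orbits and 1,2-factors\<close>

lemma adjacency_sym: "sym (adjacency G)"
  by (auto simp: sym_def adjacency_def insert_commute)

lemma component_of_eqI:
  assumes "(u, v) \<in> (adjacency G)\<^sup>*"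
  shows "component_of G v = component_of G u"
proof -
  have "(v, u) \<in> (adjacency G)\<^sup>*"
    using sym_rtrancl[OF adjacency_sym] assms by (rule symD)
  with assms have "(adjacency G)\<^sup>* `` {v} = (adjacency G)\<^sup>* `` {u}"
    by (auto intro: rtrancl_trans)
  then show ?thesis by (simp add: component_of_def)
qed

text \<open>The only neighbours of a vertex are its image and its preimage under \<open>f\<close>,
  so the vertices reachable from \<open>v\<close> form its orbit. The list
  \<open>support f v\<close> runs through this orbit in the order \<open>v\<close>,
  \<open>f v\<close>, and so on, up to the period.\<close>

lemma component_of_orbit:
  assumes p: "permutation f" and fV: "f permutes V" and v: "v \<in> V"
  shows "component_of (UGraph V ((\<lambda>a. {a, f a}) ` V)) v = circuit (support f v)"
proof -
  let ?H = "UGraph V ((\<lambda>a. {a, f a}) ` V)"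
  let ?xs = "support f v" and ?n = "least_power f v"
  define C where "C = set ?xs"
  have C: "C = range (\<lambda>i. (f ^^ i) v)"
    unfolding C_def by (rule support_set[OF p])
  have n: "(f ^^ ?n) v = v" "?n > 0"
    using least_power_of_permutation[OF p] by blast+
  have closed: "f u \<in> C" if "u \<in> C" for u
    using that unfolding C by (auto intro: range_eqI[of _ _ "Suc _"])
  \<comment> \<open>An edge may also be walked against \<open>f\<close>. Adding a full period to the
    exponent makes it positive, so one application of \<open>f\<close> can be cancelled by
    injectivity.\<close>
  have closed': "w \<in> C" if w: "f w \<in> C" for w
  proof -
    obtain i where "f w = (f ^^ i) v" using w unfolding C by blast
    also have "\<dots> = (f ^^ (i + ?n)) v" by (simp add: funpow_add n(1))
    also have "\<dots> = f ((f ^^ (i + (?n - 1))) v)"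
      using n(2) by (cases ?n) simp_all
    finally have "w = (f ^^ (i + (?n - 1))) v"
      using permutes_inj[OF fV] by (simp add: inj_eq)
    then show ?thesis unfolding C by blast
  qed
  have inV: "(f ^^ i) v \<in> V" for i
    using v permutes_in_image[OF permutes_funpow[OF fV]] by blast
  have "(adjacency ?H)\<^sup>* `` {v} = C"
  proof (intro set_eqI iffI)
    fix w assume "w \<in> (adjacency ?H)\<^sup>* `` {v}"
    then have "(v, w) \<in> (adjacency ?H)\<^sup>*" by simp
    then show "w \<in> C"
    proof induction
      case base
      show ?case unfolding C by (rule range_eqI[of _ _ 0]) simp
    next
      case (step u w)
      from step.hyps(2) have "w = f u \<or> u = f w"
        by (auto simp: adjacency_def doubleton_eq_iff)
      with step.IH show ?case using closed closed' by blast
    qed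
  next
    fix w assume "w \<in> C"
    then obtain i where w: "w = (f ^^ i) v" unfolding C by blast
    have "(v, (f ^^ i) v) \<in> (adjacency ?H)\<^sup>*"
    proof (induction i)
      case (Suc i)
      have "((f ^^ i) v, (f ^^ Suc i) v) \<in> adjacency ?H"
        using inV by (auto simp: adjacency_def)
      with Suc show ?case by (rule rtrancl_into_rtrancl)
    qed simp
    then show "w \<in> (adjacency ?H)\<^sup>* `` {v}" by (simp add: w)
  qed
  moreover have "{e \<in> edges ?H. e \<subseteq> C} = (\<lambda>a. {a, f a}) ` C"
    using closed inV by (auto simp: C)
  ultimately have "component_of ?H v = UGraph C ((\<lambda>a. {a, f a}) ` C)"
    by (simp add: component_of_def)
  also have "\<dots> = circuit ?xs"
    unfolding C_def
  proof (rule circuit_eq[symmetric])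
    fix i assume i: "i < length ?xs"
    show "f (?xs ! i) = ?xs ! (Suc i mod length ?xs)"
    \<comment> \<open>At the last position the index wraps to 0, matching the return of
      \<open>f\<close> to \<open>v\<close> after \<open>least_power f v\<close> steps.\<close>
    proof (cases "Suc i = ?n")
      case True
      then have "f (?xs ! i) = (f ^^ ?n) v"
        using i by (metis add_0 diff_zero comp_apply funpow.simps(2) length_map length_upt nth_map nth_upt)
      then show ?thesis using True n by simp
    next
      case False
      then show ?thesis using i by simp
    qed
  qed
  finally show ?thesis .
qed

lemma matching_imp_one_two_factor:
  assumes "finite (verts G)" "graph_matching G f"
  shows "one_two_factor G (UGraph (verts G) ((\<lambda>a. {a, f a}) ` verts G))"
proof -
  have f: "f permutes verts G" "permutation f" "\<forall>a\<in>verts G. {a, f a} \<in> edges G"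
    using assms by (auto simp: graph_matching_def permutation_permutes)
  have "distinct (support f v)" "support f v \<noteq> []" for v
    using cycle_of_permutation[OF f(2)] least_power_of_permutation(2)[OF f(2)] by auto
  then have "single_edge (circuit (support f v)) \<or> cycle_graph (circuit (support f v))" for v
    unfolding single_edge_or_cycle_graph_iff by blast
  then show ?thesis
    using f unfolding one_two_factor_def spanning_subgraph_def components_def
    by (auto simp: component_of_orbit)
qed

text \<open>The rotations of the components glue to a map that keeps every component, hence is
  injective; finiteness makes it a permutation.\<close>

lemma one_two_factor_imp_matching:
  assumes G: "finite_ugraph G" and "one_two_factor G H"
  shows "\<exists>f. graph_matching G f"
proof -
  let ?V = "verts G"
  let ?K = "component_of H"
  have VH: "verts H = ?V" and EH: "edges H \<subseteq> edges G"
    and comp: "\<And>v. v \<in> ?V \<Longrightarrow> single_edge (?K v) \<or> cycle_graph (?K v)"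
    using assms(2) by (auto simp: one_two_factor_def spanning_subgraph_def components_def)
  have "\<exists>g. inj_on g (verts K) \<and> (\<forall>a\<in>verts K. g a \<in> verts K \<and> {a, g a} \<in> edges K)"
    if K: "single_edge K \<or> cycle_graph K" for K :: "'a ugraph"
  proof -
    obtain xs where xs: "distinct xs" "K = circuit xs"
      using K single_edge_or_cycle_graph_iff[of K] by blast
    let ?g = "cycle_of_list xs"
    have "K = UGraph (set xs) ((\<lambda>a. {a, ?g a}) ` set xs)"
      unfolding xs(2) using cycle_of_list_nth[OF xs(1)] by (rule circuit_eq)
    moreover have "?g permutes set xs" by (rule cycle_permutes)
    ultimately show ?thesis
      by (intro exI[of _ ?g]) (auto simp: permutes_inj_on permutes_in_image)
  qed
  \<comment> \<open>The rotation is chosen per graph \<open>K\<close>, not per vertex: all vertices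
    of one component must use the same rotation, since a cycle can be rotated in two
    directions.\<close>
  then obtain g where g: "\<And>K :: 'a ugraph. single_edge K \<or> cycle_graph K \<Longrightarrow>
      inj_on (g K) (verts K) \<and> (\<forall>a\<in>verts K. g K a \<in> verts K \<and> {a, g K a} \<in> edges K)"
    by metis
  define f where "f a = (if a \<in> ?V then g (?K a) a else a)" for a
  have self: "a \<in> verts (?K a)" for a
    by (simp add: component_of_def Let_def)
  have f: "f a \<in> verts (?K a)" "{a, f a} \<in> edges (?K a)" if "a \<in> ?V" for a
    using g[OF comp[OF that]] self[of a] that by (auto simp: f_def)
  have fE: "{a, f a} \<in> edges G" if "a \<in> ?V" for a
    using f(2)[OF that] EH by (auto simp: component_of_def Let_def)
  have fV: "f a \<in> ?V" if "a \<in> ?V" for a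
    using fE[OF that] G by (fastforce simp: finite_ugraph_def doubleton_eq_iff)
  have fK: "?K (f a) = ?K a" if "a \<in> ?V" for a
    using f(1)[OF that] by (intro component_of_eqI) (simp add: component_of_def Let_def)
  have "inj_on f ?V"
  proof (rule inj_onI)
    fix a b assume ab: "a \<in> ?V" "b \<in> ?V" "f a = f b"
    \<comment> \<open>Equal images force equal components, so both values come from the same
      injective rotation.\<close>
    then have "?K a = ?K b" using fK by metis
    then have "g (?K a) a = g (?K a) b" "b \<in> verts (?K a)"
      using ab self[of b] by (simp_all add: f_def)
    then show "a = b"
      using g[OF comp[OF ab(1)]] self[of a] by (auto dest: inj_onD)
  qed
  moreover have "finite ?V" using G by (simp add: finite_ugraph_def)
  ultimately have "bij_betw f ?V ?V"
    using fV unfolding bij_betw_def by (metis endo_inj_surj image_subsetI)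
  then have "f permutes ?V"
    by (rule bij_imp_permutes) (simp add: f_def)
  with fE show ?thesis by (auto simp: graph_matching_def)
qed

section \<open>Application to the graph of inverses\<close>

theorem proposition2p7:
  fixes S :: "'a set" and mul :: "'a \<Rightarrow> 'a \<Rightarrow> 'a"
  assumes "regular_semigroup_on S mul" and "finite S"
  shows "((\<exists>f. involution_matching S mul f) \<longleftrightarrow>
            (\<exists>F. one_factor (graph_of_inverses S mul) F)) \<and>
         ((\<exists>f. permutation_matching S mul f) \<longleftrightarrow>
            (\<exists>H. one_two_factor (graph_of_inverses S mul) H))"
proof -
  let ?G = "graph_of_inverses S mul"
  have G: "finite_ugraph ?G"
    using assms(2) by (rule finite_ugraph_graph_of_inverses)
  then have "finite (verts ?G)" by (simp add: finite_ugraph_def)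
  then have "(\<exists>f. graph_matching ?G f) \<longleftrightarrow> (\<exists>H. one_two_factor ?G H)"
    using matching_imp_one_two_factor one_two_factor_imp_matching[OF G] by blast
  then show ?thesis
    using involution_iff_one_factor[OF G]
    by (simp add: involution_matching_def permutation_matching_iff)
qed

end
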